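(* Let $1<p<2$, $\beta\in\mathbb{R}$, and $\theta:=\operatorname{dist}(\beta,\mathbb{Z})$. Then for all complex-valued $u\in C_c^\infty(\mathbb{R}^2)$, $$\int_{\mathbb{R}^2}|\nabla_{A_\beta}u|^p\,dx\ \ge\ \left[\left(\frac{2-p}{p}\right)^2+\left(\frac{\sin(\pi\theta)}{\pi}\right)^2\right]^{p/2}\int_{\mathbb{R}^2}\frac{|u|^p}{|x|^p}\,dx .$$
   Context: The two-dimensional Aharonov--Bohm potential is $A_\beta(x)=\beta\,\dfrac{(x_2,-x_1)}{|x|^2}$ for $x=(x_1,x_2)\in\mathbb{R}^2\setminus\{0\}$. The magnetic gradient of a complex-valued function $u$ is $\nabla_{A_\beta}u:=\nabla u+iA_\beta u$, a $\mathbb{C}^2$-valued function on $\mathbb{R}^2\setminus\{0\}$, and $|\nabla_{A_\beta}u|$ is its Euclidean (Hermitian) norm in $\mathbb{C}^2$. $\operatorname{dist}(\beta,\mathbb{Z})=\min_{n\in\mathbb{Z}}|\beta-n|$. *)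

theory Defs
  imports "HOL-Analysis.Analysis"
begin

text \<open>
  \<open>Ck k f\<close>: all directional derivatives of order at most \<open>k\<close> (in arbitrary, possibly
  different directions) exist in the Frechet sense and are continuous on the whole space.
  In finite dimension this is the usual class \<open>C\<^sup>k\<close>.
\<close>

primrec Ck :: "nat \<Rightarrow> ('a::real_normed_vector \<Rightarrow> 'b::real_normed_vector) \<Rightarrow> bool" where
  "Ck 0 f \<longleftrightarrow> continuous_on UNIV f"
| "Ck (Suc k) f \<longleftrightarrow>
     (\<forall>x. f differentiable (at x)) \<and> (\<forall>v. Ck k (\<lambda>x. frechet_derivative f (at x) v))"

definition smooth :: "('a::real_normed_vector \<Rightarrow> 'b::real_normed_vector) \<Rightarrow> bool" where
  "smooth f \<longleftrightarrow> (\<forall>k. Ck k f)"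

definition test_functions :: "('a::real_normed_vector \<Rightarrow> 'b::real_normed_vector) set" where
  "test_functions = {u. smooth u \<and> compact (closure {x. u x \<noteq> 0})}"

text \<open>
  At the origin the vector potential gets the junk value \<open>0\<close> (division by zero); this
  affects only a Lebesgue null set.
\<close>

definition AB_potential :: "real \<Rightarrow> real^2 \<Rightarrow> real^2" where
  "AB_potential \<beta> x = (\<beta> / (norm x)\<^sup>2) *\<^sub>R vector [x $ 2, - (x $ 1)]"

definition gradient :: "(real^'n \<Rightarrow> complex) \<Rightarrow> real^'n \<Rightarrow> complex^'n" where
  "gradient u x = (\<chi> j. frechet_derivative u (at x) (axis j 1))"

definition magnetic_gradient ::
  "(real^'n \<Rightarrow> real^'n) \<Rightarrow> (real^'n \<Rightarrow> complex) \<Rightarrow> real^'n \<Rightarrow> complex^'n" where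
  "magnetic_gradient A u x = gradient u x + (\<chi> j. \<i> * of_real (A x $ j) * u x)"

end

theory Submission
  imports Defs
begin

text \<open>
  In polar coordinates \<open>|\<nabla>\<^sub>A u|\<^sup>2 = X\<^sup>2 + Y\<^sup>2\<close> with \<open>X = |\<partial>\<^sub>r u|\<close> and
  \<open>Y = |\<partial>\<^sub>\<phi> u - i \<beta> u| / r\<close>. Since \<open>p < 2\<close>, Young's inequality bounds \<open>(X\<^sup>2 + Y\<^sup>2)\<close> to the power \<open>p/2\<close>
  below by a combination \<open>\<kappa> X\<^sup>p + \<mu> Y\<^sup>p\<close>, with weights chosen so that it
  suffices to prove \<open>\<parallel>X\<parallel>\<^sub>p \<ge> (2 - p)/p \<cdot> \<parallel>u/r\<parallel>\<^sub>p\<close> and \<open>\<parallel>Y\<parallel>\<^sub>p \<ge> |sin \<pi>\<beta>|/\<pi> \<cdot> \<parallel>u/r\<parallel>\<^sub>p\<close> separately.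

  Polar coordinates are avoided by averaging over dilations and rotations of the plane. Along a ray,
  \<open>|u(x)|/|x|\<close> is at most the integral of \<open>X(tx)\<close> over \<open>t \<ge> 1\<close>, and \<open>\<parallel>X(t \<cdot>)\<parallel>\<^sub>p\<close> scales like \<open>t\<close> to the power \<open>-2/p\<close>.
  Along a circle, \<open>v(t) = e\<^sup>-\<^sup>i\<^sup>\<beta>\<^sup>t u(R\<^sub>t x)\<close> satisfies \<open>|v'(t)| = |x| Y(R\<^sub>t x)\<close> and
  \<open>|v(2\<pi>) - v(0)| = 2 |sin \<pi>\<beta>| |u(x)|\<close>. In both cases Minkowski's integral inequality gives the claim.
\<close>

section \<open>Scalar inequalities and Minkowski's integral inequality\<close>

text \<open>Young's inequality for \<open>h\<close> and \<open>k powr (p - 1)\<close> with exponents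
  \<open>p\<close> and \<open>p / (p - 1)\<close>. This is the tangent line bound for
  \<open>h powr p\<close> at \<open>k\<close>, arranged without subtraction so that it can be
  integrated in \<open>ennreal\<close>.\<close>

lemma powr_tangent_le:
  fixes p h k :: real
  assumes "1 < p" "0 \<le> h" "0 \<le> k"
  shows "p * k powr (p - 1) * h \<le> h powr p + (p - 1) * k powr p"
proof -
  have "h * k powr (p - 1) \<le> h powr p / p + (k powr (p - 1)) powr (p / (p - 1)) / (p / (p - 1))"
    using assms by (intro Youngs_inequality) (auto simp: field_simps)
  then have "h * k powr (p - 1) \<le> h powr p / p + k powr p * (p - 1) / p"
    using assms by (simp add: powr_powr)
  then have "p * (h * k powr (p - 1)) \<le> p * (h powr p / p + k powr p * (p - 1) / p)"
    using assms by (intro mult_left_mono) auto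
  also have "\<dots> = h powr p + (p - 1) * k powr p"
    using assms by (simp add: distrib_left)
  finally show ?thesis by (simp add: mult_ac)
qed

text \<open>Young's inequality with exponents \<open>2 / p\<close> and \<open>2 / (2 - p)\<close>,
  applied to each coordinate. Equality holds when \<open>(X, Y)\<close> is parallel to
  \<open>(c, s)\<close>, which later dictates the choice of \<open>c\<close> and
  \<open>s\<close>.\<close>

lemma sum_squares_powr_ge:
  fixes p X Y c s :: real
  assumes p: "0 < p" "p < 2" and nonneg: "0 \<le> X" "0 \<le> Y" "0 \<le> c" "0 \<le> s"
    and unit: "c\<^sup>2 + s\<^sup>2 = 1"
  shows "c powr (2 - p) * X powr p + s powr (2 - p) * Y powr p \<le> (X\<^sup>2 + Y\<^sup>2) powr (p / 2)"
proof (cases "X\<^sup>2 + Y\<^sup>2 = 0")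
  case True
  then have "X = 0" "Y = 0" by (simp_all add: sum_power2_eq_zero_iff)
  then show ?thesis using p by simp
next
  case False
  define N where "N = sqrt (X\<^sup>2 + Y\<^sup>2)"
  have N2: "N\<^sup>2 = X\<^sup>2 + Y\<^sup>2" by (simp add: N_def)
  have N: "0 < N" unfolding N_def using False
    by (simp add: order_less_le)
  have young: "d powr (2 - p) * x powr p \<le> p / 2 * x\<^sup>2 + (2 - p) / 2 * d\<^sup>2"
    if "0 \<le> x" "0 \<le> d" for x d :: real
  proof -
    have "x powr p * d powr (2 - p)
        \<le> (x powr p) powr (2 / p) / (2 / p) + (d powr (2 - p)) powr (2 / (2 - p)) / (2 / (2 - p))"
      using p that by (intro Youngs_inequality) (auto simp: field_simps)
    moreover have "(d powr (2 - p)) powr (2 / (2 - p)) = d\<^sup>2"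
    proof -
      have "(2 - p) * (2 / (2 - p)) = 2" using p by (metis diff_gt_0_iff_gt less_irrefl times_divide_eq_right nonzero_mult_div_cancel_left)
      then show ?thesis using that by (simp only: powr_powr) simp
    qed
    ultimately show ?thesis
      using p that by (simp add: powr_powr mult.commute)
  qed
  \<comment> \<open>Both sides of the claim are homogeneous of degree \<open>p\<close> in
    \<open>(X, Y)\<close>, so a unit vector suffices.\<close>
  have "c powr (2 - p) * (X / N) powr p + s powr (2 - p) * (Y / N) powr p
      \<le> p / 2 * ((X / N)\<^sup>2 + (Y / N)\<^sup>2) + (2 - p) / 2 * (c\<^sup>2 + s\<^sup>2)"
    using young[of "X / N" c] young[of "Y / N" s] nonneg N by (simp add: algebra_simps)
  also have "(X / N)\<^sup>2 + (Y / N)\<^sup>2 = 1"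
    using False by (simp add: power_divide N2 add_divide_distrib[symmetric])
  finally have "c powr (2 - p) * (X / N) powr p + s powr (2 - p) * (Y / N) powr p \<le> 1"
    unfolding unit by (simp add: field_simps)
  then have "c powr (2 - p) * X powr p + s powr (2 - p) * Y powr p \<le> N powr p"
    using nonneg N by (simp add: powr_divide field_simps)
  also have "N powr p = (X\<^sup>2 + Y\<^sup>2) powr (p / 2)"
    using N powr_powr[of N 2 "p / 2"] by (simp add: N2)
  finally show ?thesis .
qed

text \<open>
  A special case of Minkowski's integral inequality, proved with a tangent line to \<open>h \<mapsto> h\<^sup>p\<close>
  in place of Jensen's inequality, so that the integrals may be infinite.
\<close>

lemma (in pair_sigma_finite) nn_integral_powr_average_le:
  fixes w :: "'a \<Rightarrow> real" and H :: "'a \<Rightarrow> 'b \<Rightarrow> real" and K :: "'b \<Rightarrow> real"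
    and p m :: real and C :: ennreal
  assumes p: "1 < p" and m: "0 < m"
    and [measurable]: "w \<in> borel_measurable M1" "K \<in> borel_measurable M2"
      "(\<lambda>(t, x). H t x) \<in> borel_measurable (M1 \<Otimes>\<^sub>M M2)"
    and nonneg: "\<And>t. 0 \<le> w t" "\<And>t x. 0 \<le> H t x" "\<And>x. 0 \<le> K x"
    and mass: "(\<integral>\<^sup>+t. ennreal (w t) \<partial>M1) = ennreal m"
    and le: "\<And>x. x \<in> space M2 \<Longrightarrow> ennreal (K x) \<le> (\<integral>\<^sup>+t. ennreal (w t * H t x) \<partial>M1)"
    and bound: "\<And>t. w t \<noteq> 0 \<Longrightarrow> (\<integral>\<^sup>+x. ennreal (H t x powr p) \<partial>M2) \<le> C"
  shows "(\<integral>\<^sup>+x. ennreal (K x powr p) \<partial>M2) \<le> ennreal (m powr p) * C"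
proof -
  have [measurable]: "(\<lambda>t. H t x) \<in> borel_measurable M1" if "x \<in> space M2" for x
    using measurable_compose[OF measurable_Pair2'[OF that] assms(5)] by simp
  have [measurable]: "(\<lambda>x. H t x) \<in> borel_measurable M2" if "t \<in> space M1" for t
    using measurable_compose[OF measurable_Pair1'[OF that] assms(5)] by simp
  have jensen: "ennreal (K x powr p)
      \<le> ennreal (m powr (p - 1)) * (\<integral>\<^sup>+t. ennreal (w t * H t x powr p) \<partial>M1)"
    if x: "x \<in> space M2" for x
  proof -
    \<comment> \<open>The tangent is taken at \<open>k\<close>, which by \<open>le\<close> is at
      most the mean of \<open>H t x\<close> with respect to the weight \<open>w\<close>.\<close>
    define k where "k = K x / m"
    have k: "0 \<le> k" "K x = k * m" using nonneg m by (simp_all add: k_def)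
    have kp: "k powr (p - 1) * k = k powr p"
      using k p by (cases "k = 0") (simp_all add: powr_diff)
    \<comment> \<open>The second summand reappears on the right at the end of the chain. Being
      finite, it cancels even if the integral beside it is infinite.\<close>
    have "ennreal (k powr p * m) + ennreal ((p - 1) * k powr p * m)
        = ennreal (p * (k powr (p - 1) * k) * m)"
    proof -
      have "0 \<le> k powr p * m" "0 \<le> (p - 1) * k powr p * m" using p m by simp_all
      then show ?thesis unfolding kp
        by (simp add: ennreal_plus[symmetric] algebra_simps del: ennreal_plus)
    qed
    also have "\<dots> = ennreal (p * k powr (p - 1)) * ennreal (K x)"
      using p k m by (subst ennreal_mult[symmetric]) (simp_all add: algebra_simps)
    also have "\<dots> \<le> ennreal (p * k powr (p - 1)) * (\<integral>\<^sup>+t. ennreal (w t * H t x) \<partial>M1)"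
      by (intro mult_left_mono le x) simp
    also have "\<dots> = (\<integral>\<^sup>+t. ennreal (w t * (p * k powr (p - 1) * H t x)) \<partial>M1)"
      using x p nonneg by (subst nn_integral_cmult[symmetric])
        (auto simp: ennreal_mult[symmetric] algebra_simps)
    also have "\<dots> \<le> (\<integral>\<^sup>+t. ennreal (w t * (H t x powr p + (p - 1) * k powr p)) \<partial>M1)"
      using p k nonneg by (intro nn_integral_mono ennreal_leI mult_left_mono powr_tangent_le)
    also have "\<dots> = (\<integral>\<^sup>+t. ennreal (w t * H t x powr p)
                      + ennreal ((p - 1) * k powr p) * ennreal (w t) \<partial>M1)"
      using p nonneg by (intro nn_integral_cong)
        (simp add: ennreal_mult[symmetric] distrib_left mult_ac)
    also have "\<dots> = (\<integral>\<^sup>+t. ennreal (w t * H t x powr p) \<partial>M1)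
        + ennreal ((p - 1) * k powr p * m)"
      using x p m by (subst nn_integral_add)
        (auto simp: nn_integral_cmult mass ennreal_mult[symmetric])
    finally have "ennreal (k powr p * m) \<le> (\<integral>\<^sup>+t. ennreal (w t * H t x powr p) \<partial>M1)"
      by (simp add: add.commute[of _ "ennreal ((p - 1) * k powr p * m)"])
    from mult_left_mono[OF this, of "ennreal (m powr (p - 1))"]
    show ?thesis
      using m p k by (simp add: ennreal_mult[symmetric] powr_mult powr_diff field_simps)
  qed
  have "(\<integral>\<^sup>+x. ennreal (K x powr p) \<partial>M2)
      \<le> (\<integral>\<^sup>+x. ennreal (m powr (p - 1)) * (\<integral>\<^sup>+t. ennreal (w t * H t x powr p) \<partial>M1) \<partial>M2)"
    by (intro nn_integral_mono jensen)
  also have "\<dots> = ennreal (m powr (p - 1))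
      * (\<integral>\<^sup>+x. \<integral>\<^sup>+t. ennreal (w t * H t x powr p) \<partial>M1 \<partial>M2)"
    by (rule nn_integral_cmult) measurable
  also have "(\<integral>\<^sup>+x. \<integral>\<^sup>+t. ennreal (w t * H t x powr p) \<partial>M1 \<partial>M2)
      = (\<integral>\<^sup>+t. \<integral>\<^sup>+x. ennreal (w t * H t x powr p) \<partial>M2 \<partial>M1)"
    using Fubini[of "\<lambda>(t, x). ennreal (w t * H t x powr p)"] by simp
  also have "\<dots> = (\<integral>\<^sup>+t. ennreal (w t) * (\<integral>\<^sup>+x. ennreal (H t x powr p) \<partial>M2) \<partial>M1)"
    using nonneg by (intro nn_integral_cong)
      (simp add: ennreal_mult nn_integral_cmult)
  also have "\<dots> \<le> (\<integral>\<^sup>+t. C * ennreal (w t) \<partial>M1)"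
  proof (intro nn_integral_mono)
    fix t
    show "ennreal (w t) * (\<integral>\<^sup>+x. ennreal (H t x powr p) \<partial>M2) \<le> C * ennreal (w t)"
      using bound[of t] by (cases "w t = 0") (auto intro!: mult_left_mono simp: mult.commute[of C])
  qed
  also have "\<dots> = C * ennreal m"
    by (simp add: nn_integral_cmult mass)
  finally have "(\<integral>\<^sup>+x. ennreal (K x powr p) \<partial>M2) \<le> ennreal (m powr (p - 1)) * (C * ennreal m)"
    by (simp add: mult_left_mono)
  also have "\<dots> = ennreal (m powr (p - 1) * m) * C"
    using m by (simp add: ennreal_mult mult_ac)
  also have "m powr (p - 1) * m = m powr p"
    using m by (simp add: powr_diff)
  finally show ?thesis .
qed

section \<open>Increments along curves and linear changes of variables\<close>

lemma norm_diff_le_nn_integral_vector_derivative: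
  fixes f :: "real \<Rightarrow> 'a::euclidean_space"
  assumes "a \<le> b" and der: "\<And>t. (f has_vector_derivative f' t) (at t)"
    and cont: "continuous_on {a..b} f'"
  shows "ennreal (norm (f b - f a)) \<le> (\<integral>\<^sup>+t. ennreal (norm (f' t)) * indicator {a..b} t \<partial>lborel)"
proof -
  have *: "(f' has_integral (f b - f a)) {a..b}"
    using assms by (intro fundamental_theorem_of_calculus has_vector_derivative_at_within[OF der])
  have int: "(\<lambda>t. norm (f' t)) integrable_on {a..b}"
    using cont by (intro integrable_continuous_interval continuous_on_norm)
  have "norm (f b - f a) \<le> integral {a..b} (\<lambda>t. norm (f' t))"
    using integral_norm_bound_integral[OF has_integral_integrable[OF *] int]
      integral_unique[OF *] by simp
  also have "ennreal \<dots> = (\<integral>\<^sup>+t. ennreal (norm (f' t)) * indicator {a..b} t \<partial>lborel)"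
    using nn_integral_has_integral_lebesgue'[OF _ integrable_integral[OF int]] by simp
  finally show ?thesis by (simp add: ennreal_leI)
qed

lemma nn_integral_lborel_scaleR:
  fixes f :: "'a::euclidean_space \<Rightarrow> ennreal"
  assumes [measurable]: "f \<in> borel_measurable borel" and "0 < t"
  shows "(\<integral>\<^sup>+x. f x \<partial>lborel) = ennreal (t ^ DIM('a)) * (\<integral>\<^sup>+x. f (t *\<^sub>R x) \<partial>lborel)"
  using assms(2) by (subst lborel_affine[where c = t and t = "0::'a"])
    (simp_all add: nn_integral_density nn_integral_distr nn_integral_cmult ennreal_power)

text \<open>It suffices to compare the two measures on boxes. The preimage of a box is its image
  under the inverse map, which is again orthogonal and so preserves Lebesgue measure.\<close>

lemma distr_lborel_orthogonal_transformation:
  fixes f :: "real^'n::{finite,wellorder} \<Rightarrow> real^'n::_"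
  assumes f: "orthogonal_transformation f"
  shows "distr lborel borel f = lborel"
proof (rule lborel_eqI[symmetric])
  have lin: "linear f" using f by (simp add: orthogonal_transformation)
  have [measurable]: "f \<in> borel_measurable borel"
    by (intro borel_measurable_continuous_onI linear_continuous_on)
      (use lin linear_conv_bounded_linear in blast)
  fix l u :: "real^'n::_" assume le: "\<And>b. b \<in> Basis \<Longrightarrow> l \<bullet> b \<le> u \<bullet> b"
  have bij: "bij f" using f by (rule orthogonal_transformation_bij)
  have inv: "orthogonal_transformation (inv f)" using f by (rule orthogonal_transformation_inv)
  have S: "box l u \<in> lmeasurable" by simp
  have "emeasure (distr lborel borel f) (box l u) = emeasure lborel (f -` box l u)"
    by (simp add: emeasure_distr)
  also have "\<dots> = emeasure lebesgue (inv f ` box l u)"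
    using bij measurable_sets_borel[of f borel "box l u"]
    by (simp add: bij_vimage_eq_inv_image emeasure_completion)
  also have "\<dots> = measure lebesgue (inv f ` box l u)"
    using measurable_orthogonal_image[OF inv S] by (simp add: emeasure_eq_measure2)
  also have "\<dots> = emeasure lebesgue (box l u)"
    using S by (simp add: measure_orthogonal_image[OF inv S] emeasure_eq_measure2)
  also have "\<dots> = (\<Prod>b\<in>Basis. (u - l) \<bullet> b)"
    using le by (simp add: emeasure_lborel_box)
  finally show "emeasure (distr lborel borel f) (box l u) = (\<Prod>b\<in>Basis. (u - l) \<bullet> b)" .
qed simp

section \<open>Functions of class C^1\<close>

lemma Ck_1_iff:
  "Ck 1 u \<longleftrightarrow> (\<forall>x. u differentiable (at x)) \<and>
    (\<forall>v. continuous_on UNIV (\<lambda>x. frechet_derivative u (at x) v))"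
  by simp

lemma Ck_1_has_derivative:
  "Ck 1 u \<Longrightarrow> (u has_derivative frechet_derivative u (at x)) (at x)"
  using Ck_1_iff frechet_derivative_works by blast

lemma Ck_1_continuous_on: "Ck 1 u \<Longrightarrow> continuous_on S u"
  by (meson Ck_1_has_derivative continuous_at_imp_continuous_on has_derivative_continuous)

text \<open>\<open>Ck\<close> gives continuity only for each fixed direction. Expanding the
  direction in the standard basis yields joint continuity in point and direction.\<close>

lemma Ck_1_continuous_on_frechet_derivative:
  fixes u :: "'a::euclidean_space \<Rightarrow> 'b::real_normed_vector"
  assumes u: "Ck 1 u" and g: "continuous_on S g" and v: "continuous_on S v"
  shows "continuous_on S (\<lambda>z. frechet_derivative u (at (g z)) (v z))"
proof -
  have lin: "linear (frechet_derivative u (at x))" for x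
    using Ck_1_has_derivative[OF u] has_derivative_linear by blast
  have "continuous_on S (\<lambda>z. frechet_derivative u (at (g z)) b)" for b
    using u[unfolded Ck_1_iff] g
      continuous_on_compose2[of UNIV "\<lambda>x. frechet_derivative u (at x) b" S g] by blast
  then have "continuous_on S (\<lambda>z. \<Sum>b\<in>Basis. (v z \<bullet> b) *\<^sub>R frechet_derivative u (at (g z)) b)"
    by (intro continuous_intros v)
  moreover have "(\<Sum>b\<in>Basis. (y \<bullet> b) *\<^sub>R frechet_derivative u (at x) b)
      = frechet_derivative u (at x) y" for x y
    using linear_sum[OF lin, of x "\<lambda>b. (y \<bullet> b) *\<^sub>R b" Basis]
    by (simp add: euclidean_representation linear_cmul[OF lin])
  ultimately show ?thesis by simp
qed

lemma Ck_1_has_vector_derivative_compose: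
  assumes "Ck 1 u" "(g has_vector_derivative v) (at t)"
  shows "((\<lambda>t. u (g t)) has_vector_derivative frechet_derivative u (at (g t)) v) (at t)"
proof -
  have "((u \<circ> g) has_derivative (frechet_derivative u (at (g t)) \<circ> (\<lambda>h. h *\<^sub>R v))) (at t)"
    using assms Ck_1_has_derivative
    by (intro diff_chain_at) (auto simp: has_vector_derivative_def)
  moreover have "linear (frechet_derivative u (at (g t)))"
    using Ck_1_has_derivative[OF assms(1)] has_derivative_linear by blast
  ultimately show ?thesis
    by (simp add: has_vector_derivative_def o_def linear_cmul)
qed

section \<open>The radial inequality, by averaging over dilations\<close>

theorem radial_hardy_inequality:
  fixes u :: "'a::euclidean_space \<Rightarrow> 'b::euclidean_space" and p :: real
  assumes p: "1 < p" "p < DIM('a)" and u: "Ck 1 u" and supp: "bounded {x. u x \<noteq> 0}"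
  shows "ennreal (((DIM('a) - p) / p) powr p) * (\<integral>\<^sup>+x. ennreal ((norm (u x) / norm x) powr p) \<partial>lborel)
    \<le> (\<integral>\<^sup>+x. ennreal ((norm (frechet_derivative u (at x) x) / norm x) powr p) \<partial>lborel)"
    (is "_ \<le> ?C")
proof -
  define d where "d = real DIM('a)"
  define X where "X x = norm (frechet_derivative u (at x) x) / norm x" for x
  \<comment> \<open>The product \<open>w t * H t x\<close> is just \<open>X (t *\<^sub>R x)\<close>
    for \<open>t \<ge> 1\<close>. The power of \<open>t\<close> is split off so that
    \<open>H t\<close> has the same p-norm for every such \<open>t\<close>; \<open>w\<close> is
    integrable because \<open>p < d\<close>, and its mass \<open>p / (d - p)\<close> is the
    reciprocal of the constant.\<close>
  define w where "w t = t powr (- d / p) * indicator {1..} t" for t :: real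
  define H where "H t x = t powr (d / p) * X (t *\<^sub>R x)" for t x
  have d: "p < d" using p by (simp add: d_def)
  have lin: "linear (frechet_derivative u (at x))" for x
    using Ck_1_has_derivative[OF u] has_derivative_linear by blast
  have [measurable]: "u \<in> borel_measurable borel"
    by (intro borel_measurable_continuous_onI Ck_1_continuous_on u)
  have [measurable]: "(\<lambda>x. frechet_derivative u (at x) x) \<in> borel_measurable borel"
    by (intro borel_measurable_continuous_onI Ck_1_continuous_on_frechet_derivative u continuous_intros)
  have [measurable]: "X \<in> borel_measurable borel" unfolding X_def by measurable
  have [measurable]: "w \<in> borel_measurable borel" unfolding w_def by measurable
  have *: "(\<integral>\<^sup>+x. ennreal ((norm (u x) / norm x) powr p) \<partial>lborel) \<le> ennreal ((p / (d - p)) powr p) * ?C"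
  proof (rule lborel_pair.nn_integral_powr_average_le[where w = w and H = H])
    show "(\<lambda>(t, x). H t x) \<in> borel_measurable (lborel \<Otimes>\<^sub>M lborel)"
      unfolding H_def by measurable
    have "((\<lambda>t. t powr (- d / p)) has_integral -(1 powr (- d / p + 1)) / (- d / p + 1)) {1..}"
      using p d by (intro has_integral_powr_to_inf) (auto simp: field_simps)
    also have "-(1 powr (- d / p + 1)) / (- d / p + 1) = p / (d - p)"
      using p d by (simp add: field_simps)
    finally show "(\<integral>\<^sup>+t. ennreal (w t) \<partial>lborel) = ennreal (p / (d - p))"
      using nn_integral_has_integral_lebesgue'[of "{1..}" "\<lambda>t. t powr (- d / p)" "p / (d - p)"]
      by (simp add: w_def ennreal_mult' ennreal_indicator)
  next
    fix x :: 'a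
    show "ennreal (norm (u x) / norm x) \<le> (\<integral>\<^sup>+t. ennreal (w t * H t x) \<partial>lborel)"
    \<comment> \<open>At the origin the left side is 0 by division by zero.\<close>
    proof (cases "x = 0")
      case False
      obtain R where R: "\<And>y. u y \<noteq> 0 \<Longrightarrow> norm y \<le> R" using supp by (auto simp: bounded_iff)
      \<comment> \<open>The endpoint \<open>T *\<^sub>R x\<close> has norm at least
        \<open>R + 1\<close>, hence lies outside the support; the maximum ensures
        \<open>1 \<le> T\<close>.\<close>
      define T where "T = max 1 ((R + 1) / norm x)"
      have "R + 1 \<le> T * norm x"
        using False unfolding T_def by (simp add: pos_divide_le_eq[symmetric])
      then have "u (T *\<^sub>R x) = 0" using R[of "T *\<^sub>R x"] by (auto simp: T_def)
      moreover have "ennreal (norm (u (T *\<^sub>R x) - u (1 *\<^sub>R x)))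
          \<le> (\<integral>\<^sup>+t. ennreal (norm (frechet_derivative u (at (t *\<^sub>R x)) x)) * indicator {1..T} t \<partial>lborel)"
      proof (rule norm_diff_le_nn_integral_vector_derivative)
        show "((\<lambda>t. u (t *\<^sub>R x)) has_vector_derivative frechet_derivative u (at (t *\<^sub>R x)) x) (at t)" for t
          by (intro Ck_1_has_vector_derivative_compose u)
            (auto intro!: derivative_eq_intros simp: has_vector_derivative_def)
      qed (auto simp: T_def intro!: Ck_1_continuous_on_frechet_derivative u continuous_intros)
      ultimately have "ennreal (norm (u x))
          \<le> (\<integral>\<^sup>+t. ennreal (norm (frechet_derivative u (at (t *\<^sub>R x)) x)) * indicator {1..T} t \<partial>lborel)"
        by simp
      \<comment> \<open>By linearity the derivative at \<open>t *\<^sub>R x\<close> in direction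
        \<open>x\<close> has norm \<open>norm x * X (t *\<^sub>R x)\<close>; the interval is then
        enlarged to the whole half-line.\<close>
      also have "\<dots> \<le> (\<integral>\<^sup>+t. ennreal (norm x) * ennreal (w t * H t x) \<partial>lborel)"
      proof (intro nn_integral_mono)
        fix t :: real
        show "ennreal (norm (frechet_derivative u (at (t *\<^sub>R x)) x)) * indicator {1..T} t
            \<le> ennreal (norm x) * ennreal (w t * H t x)"
          using False
          by (auto simp: w_def H_def X_def ennreal_mult[symmetric] linear_cmul[OF lin] powr_minus field_simps
              split: split_indicator)
      qed
      also have "\<dots> = ennreal (norm x) * (\<integral>\<^sup>+t. ennreal (w t * H t x) \<partial>lborel)"
        unfolding H_def by (rule nn_integral_cmult) measurable
      finally have "ennreal (inverse (norm x)) * ennreal (norm (u x))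
          \<le> ennreal (inverse (norm x)) * (ennreal (norm x) * (\<integral>\<^sup>+t. ennreal (w t * H t x) \<partial>lborel))"
        by (rule mult_left_mono) simp
      then show ?thesis
        using False by (simp add: mult.assoc[symmetric] ennreal_mult[symmetric] divide_inverse mult.commute)
    qed simp
  next
    fix t assume "w t \<noteq> 0"
    then have t: "1 \<le> t" by (simp add: w_def indicator_def split: if_splits)
    \<comment> \<open>The factor of \<open>H\<close> contributes exactly the Jacobian of the
      dilation by \<open>t\<close>.\<close>
    have "(\<integral>\<^sup>+x. ennreal (H t x powr p) \<partial>lborel)
        = ennreal (t ^ DIM('a)) * (\<integral>\<^sup>+x. ennreal (X (t *\<^sub>R x) powr p) \<partial>lborel)"
    proof -
      have "0 \<le> X y" for y by (simp add: X_def)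
      then have "H t x powr p = t ^ DIM('a) * X (t *\<^sub>R x) powr p" for x
        using t p by (simp add: H_def powr_mult powr_powr d_def powr_realpow)
      then show ?thesis
        using t by (simp add: ennreal_mult nn_integral_cmult)
    qed
    also have "\<dots> = (\<integral>\<^sup>+x. ennreal (X x powr p) \<partial>lborel)"
      using t by (subst (2) nn_integral_lborel_scaleR[of _ t]) auto
    finally show "(\<integral>\<^sup>+x. ennreal (H t x powr p) \<partial>lborel) \<le> ?C"
      by (simp add: X_def)
  qed (use p d in \<open>auto simp: w_def H_def X_def\<close>)
  have "ennreal (((d - p) / p) powr p) * (\<integral>\<^sup>+x. ennreal ((norm (u x) / norm x) powr p) \<partial>lborel)
      \<le> ennreal (((d - p) / p) powr p) * (ennreal ((p / (d - p)) powr p) * ?C)"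
    by (intro mult_left_mono *) simp
  also have "\<dots> = ennreal (((d - p) / p * (p / (d - p))) powr p) * ?C"
    using p d by (subst powr_mult) (simp_all add: ennreal_mult mult.assoc)
  also have "\<dots> = ?C" using p d by simp
  finally show ?thesis by (simp add: d_def)
qed

section \<open>Rotations of the plane and the angular inequality\<close>

text \<open>The quarter turn, giving the angular direction: the derivative of \<open>u\<close> along
  \<open>perp x\<close> is its derivative in the polar angle, and
  \<open>AB_potential \<beta> x\<close> is \<open>- \<beta> / (norm x)\<^sup>2\<close> times
  \<open>perp x\<close>.\<close>

definition perp :: "real^2 \<Rightarrow> real^2" where
  "perp x = vector [- (x $ 2), x $ 1]"

lemma perp_nth [simp]: "perp x $ 1 = - (x $ 2)" "perp x $ 2 = x $ 1"
  by (simp_all add: perp_def)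

lemma linear_perp: "linear perp"
  by (rule linearI) (simp_all add: vec_eq_iff forall_2)

lemma perp_perp [simp]: "perp (perp x) = - x"
  by (simp add: vec_eq_iff forall_2)

lemma norm_perp [simp]: "norm (perp x) = norm x"
  by (simp add: norm_eq_sqrt_inner inner_vec_def sum_2 add.commute)

lemma inner_perp [simp]: "x \<bullet> perp x = 0"
  by (simp add: inner_vec_def sum_2 mult.commute)

text \<open>The flow of the vector field \<open>perp\<close>, whose orbits are the circles about the
  origin.\<close>

definition rotation :: "real \<Rightarrow> real^2 \<Rightarrow> real^2" where
  "rotation t x = cos t *\<^sub>R x + sin t *\<^sub>R perp x"

lemma continuous_on_perp [continuous_intros]:
  "continuous_on S f \<Longrightarrow> continuous_on S (\<lambda>x. perp (f x))"
  using linear_perp linear_conv_bounded_linear bounded_linear.continuous_on by blast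

lemma norm_rotation [simp]: "norm (rotation t x) = norm x"
proof -
  have "(norm (rotation t x))\<^sup>2 = ((cos t)\<^sup>2 + (sin t)\<^sup>2) * (norm x)\<^sup>2"
    unfolding rotation_def distrib_right
    by (subst norm_add_Pythagorean) (simp_all add: orthogonal_def power_mult_distrib)
  then show ?thesis by simp
qed

lemma orthogonal_transformation_rotation: "orthogonal_transformation (rotation t)"
proof -
  have "linear (rotation t)"
    unfolding rotation_def using linear_perp
    by (intro linear_compose_add linear_compose_scale_right linear_id[unfolded id_def])
  then show ?thesis by (simp add: orthogonal_transformation)
qed

lemma has_vector_derivative_rotation:
  "((\<lambda>t. rotation t x) has_vector_derivative perp (rotation t x)) (at t)"
proof -
  have "perp (rotation t x) = - sin t *\<^sub>R x + cos t *\<^sub>R perp x"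
    by (simp add: rotation_def linear_add[OF linear_perp] linear_cmul[OF linear_perp])
  then show ?thesis
    unfolding rotation_def
    by (auto intro!: derivative_eq_intros simp: has_real_derivative_iff_has_vector_derivative[symmetric])
qed

theorem angular_hardy_inequality:
  fixes u :: "real^2 \<Rightarrow> complex"
  assumes p: "1 < p" and u: "Ck 1 u"
  shows "ennreal ((\<bar>sin (pi * \<beta>)\<bar> / pi) powr p) * (\<integral>\<^sup>+x. ennreal ((norm (u x) / norm x) powr p) \<partial>lborel)
    \<le> (\<integral>\<^sup>+x. ennreal ((norm (frechet_derivative u (at x) (perp x) - \<i> * \<beta> * u x) / norm x) powr p) \<partial>lborel)"
    (is "_ \<le> ?C")
proof -
  define W where "W x = frechet_derivative u (at x) (perp x) - \<i> * \<beta> * u x" for x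
  define Y where "Y x = norm (W x) / norm x" for x
  \<comment> \<open>This is the modulus of \<open>exp (- 2 * pi * \<i> * \<beta>) - 1\<close>, the
    factor by which the phase fails to close up after a full turn. Dividing by the length
    \<open>2 * pi\<close> of the interval gives the constant.\<close>
  define \<sigma> where "\<sigma> = 2 * \<bar>sin (pi * \<beta>)\<bar>"
  have contW: "continuous_on S W" for S
    unfolding W_def
    by (intro Ck_1_continuous_on_frechet_derivative continuous_intros Ck_1_continuous_on u)
  have [measurable]: "u \<in> borel_measurable borel"
    by (intro borel_measurable_continuous_onI Ck_1_continuous_on u)
  have [measurable]: "W \<in> borel_measurable borel"
    by (intro borel_measurable_continuous_onI contW)
  have [measurable]: "Y \<in> borel_measurable borel" unfolding Y_def by measurable
  have [measurable]: "perp \<in> borel_measurable borel"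
    by (intro borel_measurable_continuous_onI continuous_intros)
  have [measurable]: "rotation t \<in> borel_measurable borel" for t
    unfolding rotation_def by measurable
  have *: "(\<integral>\<^sup>+x. ennreal ((\<sigma> * norm (u x) / norm x) powr p) \<partial>lborel) \<le> ennreal ((2 * pi) powr p) * ?C"
  proof (rule lborel_pair.nn_integral_powr_average_le[where w = "indicator {0..2 * pi}" and H = "\<lambda>t x. Y (rotation t x)"])
    show "(\<lambda>(t, x). Y (rotation t x)) \<in> borel_measurable (lborel \<Otimes>\<^sub>M lborel)"
      unfolding rotation_def by measurable
    show "(\<integral>\<^sup>+t. ennreal (indicator {0..2 * pi} t) \<partial>lborel) = ennreal (2 * pi)"
      by (simp add: ennreal_indicator)
  next
    fix x :: "real^2"
    \<comment> \<open>The exponential is an integrating factor: it absorbs the term with \<beta>, so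
      that the derivative of \<open>v\<close> is \<open>W\<close> along the circle times a
      phase.\<close>
    define v where "v t = exp (- (\<i> * \<beta> * t)) * u (rotation t x)" for t :: real
    define v' where "v' t = exp (- (\<i> * \<beta> * t)) * W (rotation t x)" for t :: real
    have "norm (exp (\<i> * of_real (- (2 * pi * \<beta>))) - 1) = \<sigma>"
      unfolding dist_exp_i_1 \<sigma>_def by simp
    moreover have "v (2 * pi) - v 0 = (exp (\<i> * of_real (- (2 * pi * \<beta>))) - 1) * u x"
      by (simp add: v_def rotation_def algebra_simps)
    ultimately have "ennreal (\<sigma> * norm (u x)) = ennreal (norm (v (2 * pi) - v 0))"
      by (simp add: norm_mult)
    also have "\<dots> \<le> (\<integral>\<^sup>+t. ennreal (norm (v' t)) * indicator {0..2 * pi} t \<partial>lborel)"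
    proof (rule norm_diff_le_nn_integral_vector_derivative)
      fix t :: real
      have "((\<lambda>t::real. exp (- (\<i> * \<beta> * t))) has_vector_derivative
          - (\<i> * \<beta>) * exp (- (\<i> * \<beta> * t))) (at t)"
        by (rule has_vector_derivative_real_field[where f = "\<lambda>z. exp (- (\<i> * \<beta> * z))"])
          (auto intro!: derivative_eq_intros)
      from has_vector_derivative_mult[OF this
          Ck_1_has_vector_derivative_compose[OF u has_vector_derivative_rotation]]
      show "(v has_vector_derivative v' t) (at t)"
        unfolding v_def v'_def W_def by (simp add: algebra_simps)
      show "continuous_on {0..2 * pi} v'"
        unfolding v'_def rotation_def
        by (intro continuous_intros continuous_on_compose2[OF contW]) auto
    qed simp
    finally have **: "ennreal (\<sigma> * norm (u x))
        \<le> (\<integral>\<^sup>+t. ennreal (norm (W (rotation t x))) * indicator {0..2 * pi} t \<partial>lborel)"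
      by (simp add: v'_def norm_mult)
    \<comment> \<open>Since rotations preserve the norm, the factor \<open>inverse (norm x)\<close>
      turns \<open>W\<close> into \<open>Y\<close> under the integral. At the origin all terms are
      0.\<close>
    have "ennreal (\<sigma> * norm (u x) / norm x) = ennreal (inverse (norm x)) * ennreal (\<sigma> * norm (u x))"
      by (simp add: ennreal_mult'[symmetric] divide_inverse mult.commute)
    also have "\<dots> \<le> ennreal (inverse (norm x))
        * (\<integral>\<^sup>+t. ennreal (norm (W (rotation t x))) * indicator {0..2 * pi} t \<partial>lborel)"
      by (intro mult_left_mono **) simp
    also have "\<dots> = (\<integral>\<^sup>+t. ennreal (inverse (norm x))
        * (ennreal (norm (W (rotation t x))) * indicator {0..2 * pi} t) \<partial>lborel)"
      unfolding rotation_def by (rule nn_integral_cmult[symmetric]) measurable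
    also have "\<dots> = (\<integral>\<^sup>+t. ennreal (indicator {0..2 * pi} t * Y (rotation t x)) \<partial>lborel)"
      by (intro nn_integral_cong)
        (auto simp: Y_def ennreal_mult'[symmetric] divide_inverse mult.commute split: split_indicator)
    finally show "ennreal (\<sigma> * norm (u x) / norm x)
        \<le> (\<integral>\<^sup>+t. ennreal (indicator {0..2 * pi} t * Y (rotation t x)) \<partial>lborel)" .
  next
    \<comment> \<open>Rotations preserve Lebesgue measure, so the bound is the same for every
      \<open>t\<close>.\<close>
    fix t :: real
    have "(\<integral>\<^sup>+x. ennreal (Y (rotation t x) powr p) \<partial>lborel)
        = (\<integral>\<^sup>+x. ennreal (Y x powr p) \<partial>distr lborel borel (rotation t))"
      by (simp add: nn_integral_distr)
    then show "(\<integral>\<^sup>+x. ennreal (Y (rotation t x) powr p) \<partial>lborel) \<le> ?C"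
      by (simp add: distr_lborel_orthogonal_transformation[OF orthogonal_transformation_rotation]
          Y_def W_def)
  qed (use p in \<open>auto simp: \<sigma>_def Y_def\<close>)
  have "ennreal ((\<bar>sin (pi * \<beta>)\<bar> / pi) powr p) * (\<integral>\<^sup>+x. ennreal ((norm (u x) / norm x) powr p) \<partial>lborel)
     = ennreal (inverse (2 * pi) powr p) * (\<integral>\<^sup>+x. ennreal ((\<sigma> * norm (u x) / norm x) powr p) \<partial>lborel)"
    by (subst (1 2) nn_integral_cmult[symmetric])
      (auto simp: ennreal_mult[symmetric] powr_mult[symmetric] \<sigma>_def field_simps)
  also have "\<dots> \<le> ennreal (inverse (2 * pi) powr p) * (ennreal ((2 * pi) powr p) * ?C)"
    by (intro mult_left_mono *) simp
  also have "\<dots> = ennreal ((inverse (2 * pi) * (2 * pi)) powr p) * ?C"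
    by (subst powr_mult) (simp_all add: ennreal_mult mult.assoc)
  also have "\<dots> = ?C" by simp
  finally show ?thesis .
qed

section \<open>Splitting the magnetic gradient into radial and angular parts\<close>

lemma magnetic_gradient_AB_norm:
  fixes u :: "real^2 \<Rightarrow> complex"
  assumes u: "Ck 1 u" and x: "x \<noteq> 0"
  shows "(norm (magnetic_gradient (AB_potential \<beta>) u x))\<^sup>2
    = (norm (frechet_derivative u (at x) x) / norm x)\<^sup>2
      + (norm (frechet_derivative u (at x) (perp x) - \<i> * \<beta> * u x) / norm x)\<^sup>2"
proof -
  have lin: "linear (frechet_derivative u (at x))"
    using Ck_1_has_derivative[OF u] has_derivative_linear by blast
  define a where "a = frechet_derivative u (at x) (axis 1 1)"
  define b where "b = frechet_derivative u (at x) (axis 2 1)"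
  define r where "r = (norm x)\<^sup>2"
  have r: "r = (x $ 1)\<^sup>2 + (x $ 2)\<^sup>2" "r \<noteq> 0"
    using x by (simp_all add: r_def) (simp add: norm_vec_def L2_set_def sum_2)
  have D: "frechet_derivative u (at x) y = y $ 1 *\<^sub>R a + y $ 2 *\<^sub>R b" for y
  proof -
    have "y = y $ 1 *\<^sub>R axis 1 1 + y $ 2 *\<^sub>R axis 2 1"
      by (simp add: vec_eq_iff forall_2 axis_def)
    then have "frechet_derivative u (at x) y
        = frechet_derivative u (at x) (y $ 1 *\<^sub>R axis 1 1 + y $ 2 *\<^sub>R axis 2 1)" by simp
    then show ?thesis by (simp only: linear_add[OF lin] linear_cmul[OF lin] a_def b_def)
  qed
  \<comment> \<open>\<open>g\<close> and \<open>h\<close> are the Cartesian components of the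
    magnetic gradient.\<close>
  define g where "g = a + \<i> * of_real (\<beta> / r * x $ 2) * u x"
  define h where "h = b - \<i> * of_real (\<beta> / r * x $ 1) * u x"
  have 1: "(norm (magnetic_gradient (AB_potential \<beta>) u x))\<^sup>2 = (norm g)\<^sup>2 + (norm h)\<^sup>2"
    by (simp add: norm_vec_def L2_set_def sum_2 magnetic_gradient_def gradient_def AB_potential_def
        a_def b_def g_def h_def r_def)
  \<comment> \<open>The potential is tangential, so its contributions cancel in the radial
    direction.\<close>
  have 2: "frechet_derivative u (at x) x = x $ 1 *\<^sub>R g + x $ 2 *\<^sub>R h"
    unfolding D g_def h_def by (simp add: scaleR_conv_of_real algebra_simps)
  \<comment> \<open>The left side is minus the inner product of the potential with
    \<open>perp x\<close>.\<close>
  have "\<beta> / r * x $ 2 * x $ 2 + \<beta> / r * x $ 1 * x $ 1 = \<beta>"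
  proof -
    have "\<beta> / r * x $ 2 * x $ 2 + \<beta> / r * x $ 1 * x $ 1 = \<beta> / r * r"
      by (subst (3) r(1)) (simp add: algebra_simps power2_eq_square)
    then show ?thesis using r(2) by simp
  qed
  then have "\<i> * \<beta> * u x = \<i> * of_real (\<beta> / r * x $ 2 * x $ 2 + \<beta> / r * x $ 1 * x $ 1) * u x"
    by simp
  then have 3: "frechet_derivative u (at x) (perp x) - \<i> * \<beta> * u x = x $ 1 *\<^sub>R h - x $ 2 *\<^sub>R g"
    by (simp only: D g_def h_def perp_nth) (simp add: scaleR_conv_of_real algebra_simps)
  \<comment> \<open>A real rotation combined with scaling by \<open>norm x\<close> acts on
    \<open>(g, h)\<close>; the cross terms cancel.\<close>
  have "(norm (x $ 1 *\<^sub>R g + x $ 2 *\<^sub>R h))\<^sup>2 + (norm (x $ 1 *\<^sub>R h - x $ 2 *\<^sub>R g))\<^sup>2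
      = ((norm g)\<^sup>2 + (norm h)\<^sup>2) * r"
    unfolding r(1) cmod_power2 by (simp add: power2_eq_square algebra_simps)
  then show ?thesis
    unfolding 1 2 3 using r(2) by (simp add: power_divide r_def[symmetric] field_simps)
qed

section \<open>Combining the radial and angular inequalities\<close>

theorem theorem1p3:
  fixes p \<beta> \<theta> :: real and u :: "real^2 \<Rightarrow> complex"
  assumes "1 < p" and "p < 2"
    and "\<theta> = infdist \<beta> \<int>"
    and "u \<in> test_functions"
  shows "(\<integral>\<^sup>+x. ennreal (norm (magnetic_gradient (AB_potential \<beta>) u x) powr p) \<partial>lborel)
    \<ge> ennreal ((((2 - p) / p)\<^sup>2 + (sin (pi * \<theta>) / pi)\<^sup>2) powr (p / 2))
       * (\<integral>\<^sup>+x. ennreal (norm (u x) powr p / norm x powr p) \<partial>lborel)"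
proof -
  have p: "1 < p" "p < 2" by fact+
  have u: "Ck 1 u" using assms(4) unfolding test_functions_def smooth_def by blast
  have supp: "bounded {x. u x \<noteq> 0}"
    using assms(4) unfolding test_functions_def
    by (auto intro: bounded_subset[OF compact_imp_bounded closure_subset])
  obtain n where n: "n \<in> \<int>" "\<theta> = dist \<beta> n"
    using infdist_attains_inf[of \<int> \<beta>] assms(3) by (metis closed_Ints Ints_0 empty_iff)
  \<comment> \<open>The squared sine is even and has period \<open>pi\<close>, so \<theta> may be
    replaced by \<beta>.\<close>
  have sin_theta: "(sin (pi * \<theta>))\<^sup>2 = (sin (pi * \<beta>))\<^sup>2"
  proof -
    have "pi * \<theta> = pi * (\<beta> - n) \<or> pi * \<theta> = - (pi * (\<beta> - n))"
      by (auto simp: n(2) dist_real_def abs_if right_diff_distrib)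
    then have "(sin (pi * \<theta>))\<^sup>2 = (sin (pi * (\<beta> - n)))\<^sup>2"
      by (metis power2_minus sin_minus)
    also have "\<dots> = (sin (pi * \<beta>))\<^sup>2"
    proof -
      have "sin (pi * n) = 0"
        using n(1) by (auto elim!: Ints_cases simp: sin_zero_iff_int2)
      then show ?thesis
        by (simp add: right_diff_distrib sin_diff power_mult_distrib cos_squared_eq)
    qed
    finally show ?thesis .
  qed
  define X where "X x = norm (frechet_derivative u (at x) x) / norm x" for x
  define Y where "Y x = norm (frechet_derivative u (at x) (perp x) - \<i> * \<beta> * u x) / norm x" for x
  define I where "I = (\<integral>\<^sup>+x. ennreal ((norm (u x) / norm x) powr p) \<partial>lborel)"
  define a where "a = (2 - p) / p"
  define b where "b = \<bar>sin (pi * \<beta>)\<bar> / pi"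
  define q where "q = sqrt (a\<^sup>2 + b\<^sup>2)"
  have a: "0 < a" and b: "0 \<le> b" using p by (simp_all add: a_def b_def)
  have q2: "q\<^sup>2 = a\<^sup>2 + b\<^sup>2" by (simp add: q_def)
  have q: "0 < q" unfolding q_def using a by (simp add: add_pos_nonneg)
  \<comment> \<open>The unit vector \<open>(a / q, b / q)\<close> is the equality case of Young's
    inequality at \<open>(a, b)\<close>, so nothing is lost when the constants are combined in
    \<open>pq\<close>.\<close>
  define \<kappa> where "\<kappa> = (a / q) powr (2 - p)"
  define \<mu> where "\<mu> = (b / q) powr (2 - p)"
  have radial: "ennreal (a powr p) * I \<le> (\<integral>\<^sup>+x. ennreal (X x powr p) \<partial>lborel)"
    using radial_hardy_inequality[OF p(1) _ u supp] p(2) by (simp add: a_def I_def X_def)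
  have angular: "ennreal (b powr p) * I \<le> (\<integral>\<^sup>+x. ennreal (Y x powr p) \<partial>lborel)"
    using angular_hardy_inequality[OF p(1) u] by (simp add: b_def I_def Y_def)
  have [measurable]: "X \<in> borel_measurable borel" "Y \<in> borel_measurable borel"
    unfolding X_def Y_def
    by (intro borel_measurable_divide borel_measurable_norm borel_measurable_continuous_onI
        Ck_1_continuous_on_frechet_derivative Ck_1_continuous_on continuous_intros u)+
  have pointwise: "\<kappa> * X x powr p + \<mu> * Y x powr p \<le> norm (magnetic_gradient (AB_potential \<beta>) u x) powr p"
    for x
  proof (cases "x = 0")
    \<comment> \<open>Division by zero makes \<open>X\<close> and \<open>Y\<close> vanish at the
      origin.\<close>
    case True
    then show ?thesis using p by (simp add: X_def Y_def)
  next
    case False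
    have "\<kappa> * X x powr p + \<mu> * Y x powr p \<le> ((X x)\<^sup>2 + (Y x)\<^sup>2) powr (p / 2)"
      unfolding \<kappa>_def \<mu>_def using p a b q
      by (intro sum_squares_powr_ge)
        (auto simp: X_def Y_def power_divide add_divide_distrib[symmetric] q2[symmetric])
    also have "(X x)\<^sup>2 + (Y x)\<^sup>2 = norm (magnetic_gradient (AB_potential \<beta>) u x) powr 2"
      by (simp add: magnetic_gradient_AB_norm[OF u False] X_def Y_def)
    finally show ?thesis unfolding powr_powr by simp
  qed
  have pq: "\<kappa> * a powr p + \<mu> * b powr p = (a\<^sup>2 + b\<^sup>2) powr (p / 2)"
  proof -
    \<comment> \<open>The value \<open>c = 0\<close> does occur: \<open>b\<close> vanishes when
      \<beta> is an integer.\<close>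
    have split: "(c / q) powr (2 - p) * c powr p = c\<^sup>2 / q powr (2 - p)" if "0 \<le> c" for c
      using that p q by (cases "c = 0") (simp_all add: powr_divide powr_add[symmetric])
    have "\<kappa> * a powr p + \<mu> * b powr p = q powr 2 / q powr (2 - p)"
      using a b q q2 by (simp add: \<kappa>_def \<mu>_def split add_divide_distrib)
    also have "\<dots> = q powr p"
      by (subst powr_diff[symmetric]) simp
    also have "\<dots> = (q powr 2) powr (p / 2)"
      by (simp add: powr_powr)
    finally show ?thesis using q q2 by simp
  qed
  have "ennreal ((a\<^sup>2 + b\<^sup>2) powr (p / 2)) * I
      = ennreal \<kappa> * (ennreal (a powr p) * I) + ennreal \<mu> * (ennreal (b powr p) * I)"
    unfolding pq[symmetric]
    by (simp add: \<kappa>_def \<mu>_def ennreal_mult distrib_right mult.assoc)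
  also have "\<dots> \<le> ennreal \<kappa> * (\<integral>\<^sup>+x. ennreal (X x powr p) \<partial>lborel)
      + ennreal \<mu> * (\<integral>\<^sup>+x. ennreal (Y x powr p) \<partial>lborel)"
    by (intro add_mono mult_left_mono radial angular) simp_all
  also have "\<dots> = (\<integral>\<^sup>+x. ennreal (\<kappa> * X x powr p + \<mu> * Y x powr p) \<partial>lborel)"
    by (simp add: nn_integral_add nn_integral_cmult \<kappa>_def \<mu>_def ennreal_mult)
  also have "\<dots> \<le> (\<integral>\<^sup>+x. ennreal (norm (magnetic_gradient (AB_potential \<beta>) u x) powr p) \<partial>lborel)"
    by (intro nn_integral_mono ennreal_leI pointwise)
  finally show ?thesis
    by (simp add: a_def b_def I_def sin_theta power_divide powr_divide)
qed

end
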